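(* Let $G=(I,A,\iota,(u_i)_{i\in I})$ be a game with infinite past such that for each $n\in\mathbb{Z}_0$ the restriction $\iota_n:P_n\to I$ of $\iota$ to the positions in stage $n$ is continuous, where $P_n$ carries the product topology (with $A$ discrete) and $I$ is discrete. For each player $i\in I$, let $g_i:I\times A\to\mathbb{R}$ be a function. Assume that, for some discount factor $\delta\in(0,1)$ and for each player $i\in I$ and each run $r=(\ldots,a_{-1},a_0)$, with sequence of active players $(\ldots,j_{-1},j_0)$ where $j_n=\iota(r_{<n})$, player $i$'s payoff is $$u_i(r)=(1-\delta)\sum_{n=-\infty}^{0}\delta^{-n}g_i(j_n,a_n)=(1-\delta)\big(g_i(j_0,a_0)+\delta g_i(j_{-1},a_{-1})+\delta^2 g_i(j_{-2},a_{-2})+\cdots\big).$$ Then the game $G$ admits an equilibrium.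
   Context: Let $\mathbb{Z}_0=\{\ldots,-2,-1,0\}$ and, for $n\in\mathbb{Z}_0$, $\mathbb{Z}_n=\{\ldots,n-1,n\}$. A game with infinite past is a tuple $G=(I,A,\iota,(u_i)_{i\in I})$ where $I$ is a nonempty finite set of players; $A$ is a finite set of actions with $|A|\ge 2$; a position in stage $n\in\mathbb{Z}_0$ is a sequence $p_n=(\ldots,a_{n-2},a_{n-1})\in P_n:=A^{\mathbb{Z}_{n-1}}$, and $P=\bigcup_{n\in\mathbb{Z}_0}P_n$ (a disjoint union); a run is a sequence $r=(\ldots,a_{-1},a_0)\in R:=A^{\mathbb{Z}_0}$; $\iota:P\to I$ assigns to each position the player who controls it (the active player); $u_i:R\to\mathbb{R}$ is a bounded payoff function for each $i\in I$. For a run $r=(\ldots,a_{-1},a_0)$, $r_{<n}=(\ldots,a_{n-2},a_{n-1})$ is the position in stage $n$ along $r$. A strategy of player $i$ is a map $s_i:\{p\in P:\iota(p)=i\}\to A$; a strategy profile is $s=(s_i)_{i\in I}$. A run $r=(\ldots,a_{-1},a_0)$ is consistent with $s_i$ if $a_n=s_i(r_{<n})$ for every $n\in\mathbb{Z}_0$ with $\iota(r_{<n})=i$; it is consistent with $s$ if it is consistent with every $s_i$. $R(s)$ is the set of runs consistent with $s$. For a position $p_n\in P_n$, the subgame $G[p_n]$ is the finite game played in stages $n,\ldots,-1,0$ that arises when the actions up to stage $n-1$ are given by $p_n$; a strategy profile $s$ induces a strategy profile $s[p_n]$ in it. A traditional equilibrium of $G[p_n]$ is a pure Nash equilibrium of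 this finite game. Equilibrium: a pair $(s,r)$, with $s$ a strategy profile and $r\in R(s)$, such that for each $n\in\mathbb{Z}_0$, $s[r_{<n}]$ is a traditional equilibrium of $G[r_{<n}]$. *)

theory Defs
  imports "HOL-Analysis.Analysis"
begin

(* Stages are the integers n <= 0.  A sequence of actions indexed by a set J of stages is an
   element of J \<rightarrow>\<^sub>E A.  Positions carry their stage, so that positions in different
   stages are distinct whatever the action set is. *)

type_synonym 'a position = "int \<times> (int \<Rightarrow> 'a)"

record ('i, 'a) game =
  players :: "'i set"
  actions :: "'a set"
  active :: "'a position \<Rightarrow> 'i"
  payoff :: "'i \<Rightarrow> (int \<Rightarrow> 'a) \<Rightarrow> real"

definition stage_positions :: "('i, 'a) game \<Rightarrow> int \<Rightarrow> (int \<Rightarrow> 'a) set" where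
  "stage_positions G n = {..<n} \<rightarrow>\<^sub>E actions G"

definition positions :: "('i, 'a) game \<Rightarrow> 'a position set" where
  "positions G = (SIGMA n:{..0}. stage_positions G n)"

definition runs :: "('i, 'a) game \<Rightarrow> (int \<Rightarrow> 'a) set" where
  "runs G = {..0} \<rightarrow>\<^sub>E actions G"

definition infinite_past_game :: "('i, 'a) game \<Rightarrow> bool" where
  "infinite_past_game G \<longleftrightarrow>
     finite (players G) \<and> players G \<noteq> {} \<and>
     finite (actions G) \<and> card (actions G) \<ge> 2 \<and>
     active G \<in> positions G \<rightarrow> players G \<and>
     (\<forall>i\<in>players G. bounded (payoff G i ` runs G))"

definition stage_topology :: "('i, 'a) game \<Rightarrow> int \<Rightarrow> (int \<Rightarrow> 'a) topology" where
  "stage_topology G n = product_topology (\<lambda>_. discrete_topology (actions G)) {..<n}"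

lemma topspace_stage_topology: "topspace (stage_topology G n) = stage_positions G n"
  by (simp add: stage_topology_def stage_positions_def)

definition before :: "(int \<Rightarrow> 'a) \<Rightarrow> int \<Rightarrow> (int \<Rightarrow> 'a)" where
  "before r n = restrict r {..<n}"

definition strategies :: "('i, 'a) game \<Rightarrow> 'i \<Rightarrow> ('a position \<Rightarrow> 'a) set" where
  "strategies G i = {p \<in> positions G. active G p = i} \<rightarrow>\<^sub>E actions G"

definition profiles :: "('i, 'a) game \<Rightarrow> ('i \<Rightarrow> 'a position \<Rightarrow> 'a) set" where
  "profiles G = (\<Pi>\<^sub>E i\<in>players G. strategies G i)"

definition consistent_with ::
  "('i, 'a) game \<Rightarrow> 'i \<Rightarrow> ('a position \<Rightarrow> 'a) \<Rightarrow> (int \<Rightarrow> 'a) \<Rightarrow> bool" where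
  "consistent_with G i \<sigma> r \<longleftrightarrow>
     (\<forall>n\<le>0. active G (n, before r n) = i \<longrightarrow> r n = \<sigma> (n, before r n))"

definition consistent_runs :: "('i, 'a) game \<Rightarrow> ('i \<Rightarrow> 'a position \<Rightarrow> 'a) \<Rightarrow> (int \<Rightarrow> 'a) set" where
  "consistent_runs G s = {r \<in> runs G. \<forall>i\<in>players G. consistent_with G i (s i) r}"

(* A finite game is played in the stages start, ..., -1, 0.  Its histories and plays record
   only the actions taken from stage start on. *)

record ('i, 'a) finite_game =
  fplayers :: "'i set"
  factions :: "'a set"
  start :: int
  factive :: "'a position \<Rightarrow> 'i"
  fpayoff :: "'i \<Rightarrow> (int \<Rightarrow> 'a) \<Rightarrow> real"

definition histories :: "('i, 'a) finite_game \<Rightarrow> 'a position set" where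
  "histories F = (SIGMA m:{start F..0}. {start F..<m} \<rightarrow>\<^sub>E factions F)"

definition plays :: "('i, 'a) finite_game \<Rightarrow> (int \<Rightarrow> 'a) set" where
  "plays F = {start F..0} \<rightarrow>\<^sub>E factions F"

definition finite_strategies :: "('i, 'a) finite_game \<Rightarrow> 'i \<Rightarrow> ('a position \<Rightarrow> 'a) set" where
  "finite_strategies F i = {h \<in> histories F. factive F h = i} \<rightarrow>\<^sub>E factions F"

definition finite_profiles :: "('i, 'a) finite_game \<Rightarrow> ('i \<Rightarrow> 'a position \<Rightarrow> 'a) set" where
  "finite_profiles F = (\<Pi>\<^sub>E i\<in>fplayers F. finite_strategies F i)"

definition generated ::
  "('i, 'a) finite_game \<Rightarrow> ('i \<Rightarrow> 'a position \<Rightarrow> 'a) \<Rightarrow> (int \<Rightarrow> 'a) \<Rightarrow> bool" where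
  "generated F t \<rho> \<longleftrightarrow> \<rho> \<in> plays F \<and>
     (\<forall>m\<in>{start F..0}. let h = (m, restrict \<rho> {start F..<m}) in \<rho> m = t (factive F h) h)"

definition outcome ::
  "('i, 'a) finite_game \<Rightarrow> ('i \<Rightarrow> 'a position \<Rightarrow> 'a) \<Rightarrow> (int \<Rightarrow> 'a)" where
  "outcome F t = (THE \<rho>. generated F t \<rho>)"

lemma generated_ex1:
  assumes act: "factive F \<in> histories F \<rightarrow> fplayers F"
    and t: "t \<in> finite_profiles F" and start: "start F \<le> 0"
  shows "\<exists>!\<rho>. generated F t \<rho>"
proof -
  let ?n = "start F" and ?c = "\<lambda>h. t (factive F h) h"
  have c: "?c h \<in> factions F" if "h \<in> histories F" for h
  proof -
    have "factive F h \<in> fplayers F" using that act by auto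
    then have "t (factive F h) \<in> finite_strategies F (factive F h)"
      using t by (auto simp: finite_profiles_def)
    then show ?thesis using that by (auto simp: finite_strategies_def)
  qed
  have ex: "m \<le> 1 \<longrightarrow> (\<exists>\<rho>\<in>{?n..<m} \<rightarrow>\<^sub>E factions F.
      \<forall>j\<in>{?n..<m}. \<rho> j = ?c (j, restrict \<rho> {?n..<j}))" if "?n \<le> m" for m
    using that
  proof (induction m rule: int_ge_induct)
    case base
    show ?case by simp
  next
    case (step m)
    show ?case
    proof
      assume m: "m + 1 \<le> 1"
      then have "m \<le> 1" by simp
      with step.IH obtain \<rho> where \<rho>: "\<rho> \<in> {?n..<m} \<rightarrow>\<^sub>E factions F"
        "\<forall>j\<in>{?n..<m}. \<rho> j = ?c (j, restrict \<rho> {?n..<j})" by blast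
      let ?\<rho> = "\<rho>(m := ?c (m, \<rho>))"
      have "(m, \<rho>) \<in> histories F"
        using \<rho>(1) m step(1) by (auto simp: histories_def)
      from c[OF this] have "?\<rho> \<in> {?n..<m + 1} \<rightarrow>\<^sub>E factions F"
        using \<rho>(1) step(1) by (auto simp: PiE_iff extensional_def)
      moreover have r: "restrict ?\<rho> {?n..<j} = restrict \<rho> {?n..<j}" if "j \<le> m" for j
        using that by (auto simp: restrict_def)
      have "restrict \<rho> {?n..<m} = \<rho>"
        using \<rho>(1) by (simp add: PiE_restrict)
      then have "\<forall>j\<in>{?n..<m + 1}. ?\<rho> j = ?c (j, restrict ?\<rho> {?n..<j})"
        using \<rho>(2) r by (auto simp: r)
      ultimately show "\<exists>\<rho>\<in>{?n..<m + 1} \<rightarrow>\<^sub>E factions F.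
          \<forall>j\<in>{?n..<m + 1}. \<rho> j = ?c (j, restrict \<rho> {?n..<j})" by blast
    qed
  qed
  have "{?n..<1} = {?n..0}" by auto
  with ex[of 1] start have "\<exists>\<rho>. generated F t \<rho>"
    by (auto simp: generated_def plays_def Let_def)
  moreover have "\<rho> = \<rho>'" if g: "generated F t \<rho>" "generated F t \<rho>'" for \<rho> \<rho>'
  proof -
    have "m \<le> 1 \<longrightarrow> (\<forall>j\<in>{?n..<m}. \<rho> j = \<rho>' j)" if "?n \<le> m" for m
      using that
    proof (induction m rule: int_ge_induct)
      case base
      show ?case by simp
    next
      case (step m)
      show ?case
      proof (intro impI ballI)
        fix j assume m: "m + 1 \<le> 1" and j: "j \<in> {?n..<m + 1}"
        have "restrict \<rho> {?n..<m} = restrict \<rho>' {?n..<m}"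
          using step m by (auto simp: restrict_def)
        moreover have "m \<in> {?n..0}" using step(1) m by auto
        ultimately have "\<rho> m = \<rho>' m"
          using g by (simp add: generated_def Let_def)
        then show "\<rho> j = \<rho>' j" using step m j by (cases "j = m") auto
      qed
    qed
    from this[of 1] start have "\<forall>j\<in>{?n..0}. \<rho> j = \<rho>' j" by auto
    then show ?thesis using g by (auto simp: generated_def plays_def intro: PiE_ext)
  qed
  ultimately show ?thesis by blast
qed

definition nash_equilibrium :: "('i, 'a) finite_game \<Rightarrow> ('i \<Rightarrow> 'a position \<Rightarrow> 'a) \<Rightarrow> bool" where
  "nash_equilibrium F t \<longleftrightarrow> t \<in> finite_profiles F \<and>
     (\<forall>i\<in>fplayers F. \<forall>\<tau>\<in>finite_strategies F i.
        fpayoff F i (outcome F (t(i := \<tau>))) \<le> fpayoff F i (outcome F t))"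

definition append_at :: "int \<Rightarrow> (int \<Rightarrow> 'a) \<Rightarrow> (int \<Rightarrow> 'a) \<Rightarrow> (int \<Rightarrow> 'a)" where
  "append_at n p h = (\<lambda>k. if k < n then p k else h k)"

definition subgame :: "('i, 'a) game \<Rightarrow> 'a position \<Rightarrow> ('i, 'a) finite_game" where
  "subgame G = (\<lambda>(n, p).
     \<lparr>fplayers = players G, factions = actions G, start = n,
      factive = (\<lambda>(m, h). active G (m, append_at n p h)),
      fpayoff = (\<lambda>i \<rho>. payoff G i (append_at n p \<rho>))\<rparr>)"

definition induced_profile ::
  "('i, 'a) game \<Rightarrow> ('i \<Rightarrow> 'a position \<Rightarrow> 'a) \<Rightarrow> 'a position \<Rightarrow> ('i \<Rightarrow> 'a position \<Rightarrow> 'a)" where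
  "induced_profile G s = (\<lambda>(n, p). \<lambda>i\<in>players G.
     \<lambda>(m, h)\<in>{h \<in> histories (subgame G (n, p)). factive (subgame G (n, p)) h = i}.
       s i (m, append_at n p h))"

lemma subgame_well_defined:
  assumes G: "infinite_past_game G" and p: "(n, p) \<in> positions G" and s: "s \<in> profiles G"
  shows "factive (subgame G (n, p)) \<in> histories (subgame G (n, p)) \<rightarrow> fplayers (subgame G (n, p))"
    and "induced_profile G s (n, p) \<in> finite_profiles (subgame G (n, p))"
proof -
  have pos: "(m, append_at n p h) \<in> positions G" if "(m, h) \<in> histories (subgame G (n, p))" for m h
    using that p
    by (auto simp: histories_def subgame_def positions_def stage_positions_def append_at_def
        PiE_iff extensional_def)
  show "factive (subgame G (n, p)) \<in> histories (subgame G (n, p)) \<rightarrow> fplayers (subgame G (n, p))"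
  proof
    fix x assume "x \<in> histories (subgame G (n, p))"
    then obtain m h where x: "x = (m, h)" and "(m, append_at n p h) \<in> positions G"
      using pos by (cases x) auto
    then have "active G (m, append_at n p h) \<in> players G"
      using G by (auto simp: infinite_past_game_def)
    then show "factive (subgame G (n, p)) x \<in> fplayers (subgame G (n, p))"
      by (simp add: x subgame_def)
  qed
  have "s i (m, append_at n p h) \<in> actions G"
    if "i \<in> players G" "(m, h) \<in> histories (subgame G (n, p))"
      "active G (m, append_at n p h) = i" for i m h
  proof -
    have "s i \<in> strategies G i" using s that(1) by (auto simp: profiles_def)
    then show ?thesis using pos[OF that(2)] that(3) by (auto simp: strategies_def)
  qed
  moreover have "fplayers (subgame G (n, p)) = players G" "factions (subgame G (n, p)) = actions G"
    "\<And>m h. factive (subgame G (n, p)) (m, h) = active G (m, append_at n p h)"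
    by (simp_all add: subgame_def)
  ultimately show "induced_profile G s (n, p) \<in> finite_profiles (subgame G (n, p))"
    by (auto simp: induced_profile_def finite_profiles_def finite_strategies_def
        split: prod.splits)
qed

definition equilibrium ::
  "('i, 'a) game \<Rightarrow> ('i \<Rightarrow> 'a position \<Rightarrow> 'a) \<Rightarrow> (int \<Rightarrow> 'a) \<Rightarrow> bool" where
  "equilibrium G s r \<longleftrightarrow> s \<in> profiles G \<and> r \<in> consistent_runs G s \<and>
     (\<forall>n\<le>0. nash_equilibrium (subgame G (n, before r n)) (induced_profile G s (n, before r n)))"

end

theory Submission
  imports Defs
begin

text \<open>
  Backward induction from stage \<open>0\<close>, carried out for all positions of a stage at once, yields
  actions that are optimal in every subgame, because the part of a payoff that accrues before a
  stage \<open>n\<close> is a constant in the subgames starting there. The part accruing from stage \<open>n\<close> on is a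
  finite sum that depends on the position only through the active players, so by continuity
  of \<open>\<iota>\<^sub>n\<close> the backward induction action is a locally constant function of the position. Hence the
  runs that follow it from stage \<open>-N\<close> on form a closed nonempty set, and compactness of \<open>R\<close> gives
  a run that follows it at every stage.
\<close>

section \<open>Locally constant functions\<close>

text \<open>This is continuity into a discrete codomain, phrased without naming the codomain as a
  set: the values will be players, actions and whole functions
  \<open>'i \<Rightarrow> real\<close>.\<close>

definition locally_constant :: "'a topology \<Rightarrow> ('a \<Rightarrow> 'b) \<Rightarrow> bool" where
  "locally_constant X f \<longleftrightarrow> (\<forall>x\<in>topspace X. \<exists>U. openin X U \<and> x \<in> U \<and> (\<forall>y\<in>U. f y = f x))"

lemma locally_constantI_continuous_map:
  assumes "continuous_map X (discrete_topology S) f"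
  shows "locally_constant X f"
  unfolding locally_constant_def
proof
  fix x assume x: "x \<in> topspace X"
  then have "f x \<in> S" using continuous_map_image_subset_topspace[OF assms] by auto
  then have "openin X {y \<in> topspace X. f y \<in> {f x}}"
    using assms by (intro openin_continuous_map_preimage) auto
  with x show "\<exists>U. openin X U \<and> x \<in> U \<and> (\<forall>y\<in>U. f y = f x)" by blast
qed

lemma locally_constant_compose:
  assumes "continuous_map X Y h" "locally_constant Y f"
  shows "locally_constant X (\<lambda>x. f (h x))"
  unfolding locally_constant_def
proof
  fix x assume x: "x \<in> topspace X"
  then have "h x \<in> topspace Y" using continuous_map_image_subset_topspace[OF assms(1)] by auto
  then obtain U where U: "openin Y U" "h x \<in> U" "\<forall>y\<in>U. f y = f (h x)"
    using assms(2) unfolding locally_constant_def by blast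
  have "openin X {y \<in> topspace X. h y \<in> U}"
    using assms(1) U(1) by (rule openin_continuous_map_preimage)
  with x U show "\<exists>V. openin X V \<and> x \<in> V \<and> (\<forall>y\<in>V. f (h y) = f (h x))" by blast
qed

text \<open>Finitely many neighbourhoods of a point, one per function, intersect in a neighbourhood
  on which all the determining data are constant. In the application \<open>K\<close> is the action
  set, \<open>f a\<close> the continuation value after action \<open>a\<close>, and \<open>e\<close>
  the active player.\<close>

lemma locally_constant_determined:
  assumes K: "finite K" and f: "\<And>k. k \<in> K \<Longrightarrow> locally_constant X (f k)"
    and e: "locally_constant X e"
    and h: "\<And>x y. x \<in> topspace X \<Longrightarrow> y \<in> topspace X \<Longrightarrow> e x = e y \<Longrightarrow>
      (\<And>k. k \<in> K \<Longrightarrow> f k x = f k y) \<Longrightarrow> h x = h y"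
  shows "locally_constant X h"
  unfolding locally_constant_def
proof
  fix x assume x: "x \<in> topspace X"
  then obtain V where V: "openin X V" "x \<in> V" "\<forall>y\<in>V. e y = e x"
    using e unfolding locally_constant_def by blast
  have "\<forall>k\<in>K. \<exists>U. openin X U \<and> x \<in> U \<and> (\<forall>y\<in>U. f k y = f k x)"
    using x f unfolding locally_constant_def by blast
  from bchoice[OF this] obtain U
    where U: "\<forall>k\<in>K. openin X (U k) \<and> x \<in> U k \<and> (\<forall>y\<in>U k. f k y = f k x)" ..
  let ?W = "V \<inter> (topspace X \<inter> (\<Inter>k\<in>K. U k))"
  have "openin X ?W"
  \<comment> \<open>An empty intersection is \<open>UNIV\<close>, which need not be open in
    \<open>X\<close>, so that case is treated apart.\<close>
  proof (cases "K = {}")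
    case False
    then have "openin X (\<Inter>k\<in>K. U k)" using K U by (intro openin_INT2) blast+
    then show ?thesis using V(1) by (intro openin_Int) auto
  qed (simp add: V(1) openin_Int)
  moreover have "x \<in> ?W" using x V(2) U by blast
  moreover have "h y = h x" if "y \<in> ?W" for y
  proof (rule h)
    show "y \<in> topspace X" "x \<in> topspace X" using that x by blast+
    show "e y = e x" using that V(3) by blast
    show "f k y = f k x" if "k \<in> K" for k using that \<open>y \<in> ?W\<close> U by blast
  qed
  ultimately show "\<exists>W. openin X W \<and> x \<in> W \<and> (\<forall>y\<in>W. h y = h x)" by blast
qed

text \<open>Near a point where \<open>f\<close> and \<open>g\<close> differ both keep their values,
  so the set of disagreement is open. This makes following the backward action at one given stage a
  closed condition on runs.\<close>

lemma closedin_locally_constant: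
  assumes "locally_constant X f" "locally_constant X g"
  shows "closedin X {x \<in> topspace X. f x = g x}"
proof -
  have "openin X {x \<in> topspace X. f x \<noteq> g x}"
  proof (subst openin_subopen, intro ballI)
    fix x assume x: "x \<in> {x \<in> topspace X. f x \<noteq> g x}"
    then have X: "x \<in> topspace X" by simp
    obtain U where U: "openin X U" "x \<in> U" "\<forall>y\<in>U. f y = f x"
      using assms(1) X unfolding locally_constant_def by blast
    obtain V where V: "openin X V" "x \<in> V" "\<forall>y\<in>V. g y = g x"
      using assms(2) X unfolding locally_constant_def by blast
    have "openin X (U \<inter> V)" using U(1) V(1) by (rule openin_Int)
    moreover have "y \<in> {x \<in> topspace X. f x \<noteq> g x}" if "y \<in> U \<inter> V" for y
    proof -
      have "f y = f x" "g y = g x" using that U(3) V(3) by blast+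
      then show ?thesis using that x openin_subset[OF U(1)] by auto
    qed
    ultimately show "\<exists>T. openin X T \<and> x \<in> T \<and> T \<subseteq> {x \<in> topspace X. f x \<noteq> g x}"
      using U(2) V(2) by blast
  qed
  moreover have "topspace X - {x \<in> topspace X. f x = g x} = {x \<in> topspace X. f x \<noteq> g x}"
    by auto
  ultimately show ?thesis by (simp add: closedin_def)
qed

section \<open>Continuity of restricting and extending positions\<close>

lemma continuous_map_before:
  assumes "m \<le> n"
  shows "continuous_map (stage_topology G n) (stage_topology G m) (\<lambda>r. before r m)"
  unfolding stage_topology_def before_def
  using assms by (auto simp: continuous_map_componentwise intro!: continuous_map_product_projection)

lemma continuous_map_extend:
  assumes "a \<in> actions G"
  shows "continuous_map (stage_topology G n) (stage_topology G (n + 1)) (\<lambda>p. p(n := a))"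
  unfolding stage_topology_def continuous_map_componentwise
proof (intro conjI ballI)
  show "(\<lambda>p. p(n := a)) ` topspace (product_topology (\<lambda>_. discrete_topology (actions G)) {..<n})
      \<subseteq> extensional {..<n + 1}"
    by (auto simp: PiE_iff extensional_def)
next
  fix k assume k: "k \<in> {..<n + 1}"
  show "continuous_map (product_topology (\<lambda>_. discrete_topology (actions G)) {..<n})
      (discrete_topology (actions G)) (\<lambda>p. (p(n := a)) k)"
    using k assms by (cases "k = n") (auto intro!: continuous_map_product_projection)
qed

text \<open>Runs act as positions of a fictitious stage 1, so the topology and the restriction
  lemmas for positions serve for runs as well.\<close>

lemma runs_eq_stage_positions: "runs G = stage_positions G 1"
proof -
  have "{..0::int} = {..<1}" by auto
  then show ?thesis by (simp add: runs_def stage_positions_def)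
qed

lemma before_in_stage_positions:
  "r \<in> stage_positions G n \<Longrightarrow> m \<le> n \<Longrightarrow> before r m \<in> stage_positions G m"
  by (auto simp: stage_positions_def before_def)

lemma before_succ: "before r (n + 1) = (before r n)(n := r n)"
  by (auto simp: before_def restrict_def)

section \<open>Backward induction: optimality and local constancy\<close>

text \<open>In the next two definitions \<open>d\<close> counts the stages after the current one, so the position
  belongs to stage \<open>- d\<close>, whereas \<open>continuation_value G g \<delta> d\<close> is evaluated at positions in
  stage \<open>1 - d\<close>. The normalising factor \<open>1 - \<delta>\<close> is left out.\<close>

definition optimal_action ::
  "('i, 'a) game \<Rightarrow> ('i \<Rightarrow> 'i \<times> 'a \<Rightarrow> real) \<Rightarrow> real \<Rightarrow> ((int \<Rightarrow> 'a) \<Rightarrow> 'i \<Rightarrow> real) \<Rightarrow> nat \<Rightarrow>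
    (int \<Rightarrow> 'a) \<Rightarrow> 'a" where
  "optimal_action G g \<delta> v d p = (let j = active G (- int d, p) in
     arg_max (\<lambda>a. \<delta> ^ d * g j (j, a) + v (p(- int d := a)) j) (\<lambda>a. a \<in> actions G))"

primrec continuation_value ::
  "('i, 'a) game \<Rightarrow> ('i \<Rightarrow> 'i \<times> 'a \<Rightarrow> real) \<Rightarrow> real \<Rightarrow> nat \<Rightarrow> (int \<Rightarrow> 'a) \<Rightarrow> 'i \<Rightarrow> real" where
  "continuation_value G g \<delta> 0 = (\<lambda>p i. 0)"
| "continuation_value G g \<delta> (Suc d) = (\<lambda>p i.
     let a = optimal_action G g \<delta> (continuation_value G g \<delta> d) d p
     in \<delta> ^ d * g i (active G (- int d, p), a) + continuation_value G g \<delta> d (p(- int d := a)) i)"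

abbreviation backward_action where
  "backward_action G g \<delta> d \<equiv> optimal_action G g \<delta> (continuation_value G g \<delta> d) d"

text \<open>On a finite nonempty action set the maximum is attained, so the Hilbert choice behind
  \<open>arg_max\<close> really picks a maximiser.\<close>

lemma optimal_action:
  assumes A: "finite (actions G)" "actions G \<noteq> {}" and j: "j = active G (- int d, p)"
  shows "optimal_action G g \<delta> v d p \<in> actions G"
    and "a \<in> actions G \<Longrightarrow> \<delta> ^ d * g j (j, a) + v (p(- int d := a)) j \<le>
      (let b = optimal_action G g \<delta> v d p in \<delta> ^ d * g j (j, b) + v (p(- int d := b)) j)"
proof -
  let ?f = "\<lambda>a. \<delta> ^ d * g j (j, a) + v (p(- int d := a)) j"
  have "Max (?f ` actions G) \<in> ?f ` actions G" using A by (intro Max_in) auto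
  then obtain b where b: "b \<in> actions G" "Max (?f ` actions G) = ?f b" by blast
  have "?f a \<le> ?f b" if "a \<in> actions G" for a
    unfolding b(2)[symmetric] using A(1) that by (intro Max_ge) auto
  then have "\<exists>b. is_arg_max ?f (\<lambda>a. a \<in> actions G) b"
    unfolding is_arg_max_linorder using b(1) by blast
  then have "is_arg_max ?f (\<lambda>a. a \<in> actions G) (arg_max ?f (\<lambda>a. a \<in> actions G))"
    unfolding arg_max_def by (rule someI_ex)
  then show "optimal_action G g \<delta> v d p \<in> actions G"
    and "a \<in> actions G \<Longrightarrow> ?f a \<le> (let b = optimal_action G g \<delta> v d p in ?f b)"
    by (auto simp: is_arg_max_linorder optimal_action_def j Let_def)
qed

text \<open>\<open>arg_max\<close> chooses from a predicate, and equal predicates give equal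
  choices. Ties between optimal actions are thus broken alike at \<open>p\<close> and
  \<open>q\<close>, which lets the chosen action inherit local constancy.\<close>

lemma optimal_action_cong:
  assumes "active G (- int d, p) = active G (- int d, q)"
    and "\<And>a. a \<in> actions G \<Longrightarrow> v (p(- int d := a)) = v (q(- int d := a))"
  shows "optimal_action G g \<delta> v d p = optimal_action G g \<delta> v d q"
  using assms unfolding optimal_action_def arg_max_def is_arg_max_linorder Let_def
  by (intro arg_cong[of _ _ Eps] ext) auto

text \<open>Induction on \<open>d\<close>. Extending a position by an action is continuous, so the
  continuation value after each action is locally constant in stage \<open>- int d\<close>. Together
  with the active player, these finitely many data determine the backward action and the next
  value.\<close>

lemma locally_constant_continuation:
  assumes A: "finite (actions G)" "actions G \<noteq> {}"
    and act: "\<forall>n\<le>0. continuous_map (stage_topology G n) (discrete_topology (players G))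
                 (\<lambda>p. active G (n, p))"
  shows "locally_constant (stage_topology G (1 - int d)) (continuation_value G g \<delta> d)"
    and "locally_constant (stage_topology G (- int d)) (backward_action G g \<delta> d)"
proof -
  let ?w = "continuation_value G g \<delta>"
  have *: "locally_constant (stage_topology G (- int d)) (backward_action G g \<delta> d) \<and>
      locally_constant (stage_topology G (- int d)) (?w (Suc d))"
    if w: "locally_constant (stage_topology G (1 - int d)) (?w d)" for d
  proof -
    have e: "locally_constant (stage_topology G (- int d)) (\<lambda>p. active G (- int d, p))"
      using act by (intro locally_constantI_continuous_map[of _ "players G"]) auto
    have f: "locally_constant (stage_topology G (- int d)) (\<lambda>p. ?w d (p(- int d := a)))"
      if "a \<in> actions G" for a
    proof (rule locally_constant_compose[OF _ w])
      have "- int d + 1 = 1 - int d" by simp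
      then show "continuous_map (stage_topology G (- int d)) (stage_topology G (1 - int d))
          (\<lambda>p. p(- int d := a))"
        using continuous_map_extend[OF that, of "- int d"] by metis
    qed
    show ?thesis
    proof (intro conjI locally_constant_determined[OF A(1) f e])
      fix p q assume *: "active G (- int d, p) = active G (- int d, q)"
        "\<And>a. a \<in> actions G \<Longrightarrow> ?w d (p(- int d := a)) = ?w d (q(- int d := a))"
      show b: "backward_action G g \<delta> d p = backward_action G g \<delta> d q"
        using * by (rule optimal_action_cong)
      \<comment> \<open>The continuation values at \<open>p\<close> and \<open>q\<close> are known
        to agree only after actions of the game, so the chosen action must be one of these.\<close>
      have "backward_action G g \<delta> d q \<in> actions G"
        using A refl by (rule optimal_action)
      then show "?w (Suc d) p = ?w (Suc d) q"
        using * b by (simp add: Let_def)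
    qed
  qed
  show w: "locally_constant (stage_topology G (1 - int d)) (?w d)"
  proof (induction d)
    case 0
    show ?case by (auto simp: locally_constant_def)
  next
    case (Suc d)
    then show ?case using * by auto
  qed
  show "locally_constant (stage_topology G (- int d)) (backward_action G g \<delta> d)"
    using *[OF w] ..
qed

text \<open>\<open>J\<close> is the set of deviating players: \<open>{i}\<close> for the inequality, empty for the equality.\<close>

lemma continuation_sum_le:
  assumes A: "finite (actions G)" "actions G \<noteq> {}" and r: "r \<in> runs G"
    and "\<forall>k<d. active G (- int k, before r (- int k)) \<notin> J \<longrightarrow>
      r (- int k) = backward_action G g \<delta> k (before r (- int k))"
    and J: "J \<subseteq> {i}"
  defines "S \<equiv> \<Sum>k<d. \<delta> ^ k * g i (active G (- int k, before r (- int k)), r (- int k))"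
    and "W \<equiv> continuation_value G g \<delta> d (before r (1 - int d)) i"
  shows "S \<le> W" and "J = {} \<Longrightarrow> S = W"
proof -
  let ?S = "\<lambda>d. \<Sum>k<d. \<delta> ^ k * g i (active G (- int k, before r (- int k)), r (- int k))"
  let ?W = "\<lambda>d. continuation_value G g \<delta> d (before r (1 - int d)) i"
  have "?S d \<le> ?W d \<and> (J = {} \<longrightarrow> ?S d = ?W d)"
    using assms(4)
  proof (induction d)
    case 0
    show ?case by simp
  next
    case (Suc d)
    let ?p = "before r (- int d)" and ?a = "r (- int d)"
    let ?j = "active G (- int d, ?p)"
    have IH: "?S d \<le> ?W d" "J = {} \<Longrightarrow> ?S d = ?W d"
      using Suc by auto
    have "1 - int d = - int d + 1" by simp
    then have p: "before r (1 - int d) = ?p(- int d := ?a)"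
      using before_succ[of r "- int d"] by metis
    let ?V = "\<delta> ^ d * g i (?j, ?a) + ?W d"
    \<comment> \<open>Strict inequality can arise only where a deviator is active. By
      \<open>J \<subseteq> {i}\<close> that player is \<open>i\<close>, whose own value the backward
      action maximises. At all other stages the recursion gives equality, whether or not the action
      suits \<open>i\<close>.\<close>
    have "?V \<le> ?W (Suc d) \<and> (?j \<notin> J \<longrightarrow> ?V = ?W (Suc d))"
    proof (cases "?j \<in> J")
      case True
      then have j: "i = ?j" using J by auto
      have "?a \<in> actions G" using r by (auto simp: runs_def)
      from optimal_action(2)[OF A j this, of \<delta> g "continuation_value G g \<delta> d"] True j
      show ?thesis by (simp add: p Let_def)
    next
      case False
      then have "?a = backward_action G g \<delta> d ?p" using Suc.prems by simp
      then show ?thesis by (simp add: p Let_def)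
    qed
    then show ?case using IH by (auto simp: lessThan_Suc)
  qed
  then show "S \<le> W" "J = {} \<Longrightarrow> S = W" by (auto simp: S_def W_def)
qed

section \<open>From plays of a subgame to runs, and the payoff from earlier stages\<close>

lemma append_at_runs:
  assumes p: "p \<in> stage_positions G n" and n: "n \<le> 0" and \<rho>: "\<rho> \<in> {n..0} \<rightarrow>\<^sub>E actions G"
  shows "append_at n p \<rho> \<in> runs G"
  using assms by (auto simp: append_at_def runs_def stage_positions_def PiE_iff extensional_def)

lemma before_append_at:
  assumes p: "p \<in> stage_positions G n" and "n \<le> m"
  shows "before (append_at n p \<rho>) m = append_at n p (restrict \<rho> {n..<m})"
  using assms by (auto simp: append_at_def before_def stage_positions_def PiE_iff extensional_def
      restrict_def)

text \<open>Histories and plays of the subgame record only actions from stage \<open>n\<close> on.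
  Gluing \<open>p\<close> in front translates them into a run and its positions, the form in which
  backward actions are stated.\<close>

lemma generated_subgame:
  assumes gen: "generated (subgame G (n, p)) t \<rho>" and p: "p \<in> stage_positions G n" and n: "n \<le> 0"
  defines "r \<equiv> append_at n p \<rho>"
  shows "r \<in> runs G" and "before r n = p"
    and "m \<in> {n..0} \<Longrightarrow> (m, restrict \<rho> {n..<m}) \<in> histories (subgame G (n, p))"
    and "m \<in> {n..0} \<Longrightarrow> r m = t (active G (m, before r m)) (m, restrict \<rho> {n..<m})"
    and "m \<in> {n..0} \<Longrightarrow> append_at n p (restrict \<rho> {n..<m}) = before r m"
proof -
  have \<rho>: "\<rho> \<in> {n..0} \<rightarrow>\<^sub>E actions G"
    using gen by (simp add: generated_def plays_def subgame_def)
  then show "r \<in> runs G" unfolding r_def by (intro append_at_runs p n)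
  show "before r n = p"
    using p by (auto simp: r_def append_at_def before_def stage_positions_def PiE_iff extensional_def)
  assume m: "m \<in> {n..0}"
  show "(m, restrict \<rho> {n..<m}) \<in> histories (subgame G (n, p))"
    using \<rho> m by (auto simp: histories_def subgame_def)
  show b: "append_at n p (restrict \<rho> {n..<m}) = before r m"
    using before_append_at[OF p, of m \<rho>] m by (simp add: r_def)
  show "r m = t (active G (m, before r m)) (m, restrict \<rho> {n..<m})"
    using gen m unfolding b[symmetric]
    by (auto simp: generated_def Let_def subgame_def r_def append_at_def)
qed

lemma induced_profile_apply:
  assumes "(m, h) \<in> histories (subgame G (n, p))" "active G (m, append_at n p h) \<in> players G"
  shows "induced_profile G s (n, p) (active G (m, append_at n p h)) (m, h) =
    s (active G (m, append_at n p h)) (m, append_at n p h)"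
  using assms by (simp add: induced_profile_def subgame_def)

text \<open>The terms with \<open>k \<ge> d\<close> belong to stages before
  \<open>1 - int d\<close>, where the two runs coincide, so both series have the same tail.\<close>

lemma payoff_split:
  fixes G :: "('i, 'a) game" and g :: "'i \<Rightarrow> 'i \<times> 'a \<Rightarrow> real" and \<delta> :: real
  assumes G: "infinite_past_game G" and \<delta>: "0 < \<delta>" "\<delta> < 1" and i: "i \<in> players G"
    and r: "r \<in> runs G" "r' \<in> runs G" and eq: "before r (1 - int d) = before r' (1 - int d)"
  defines "f \<equiv> \<lambda>r k. \<delta> ^ k * g i (active G (- int k, before r (- int k)), r (- int k))"
  shows "(\<Sum>k. f r k) - (\<Sum>k<d. f r k) = (\<Sum>k. f r' k) - (\<Sum>k<d. f r' k)"
proof -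
  have summable: "summable (f r)" if r: "r \<in> runs G" for r
  proof -
    \<comment> \<open>On pairs of a player and an action \<open>g i\<close> takes finitely many
      values, so a geometric series dominates.\<close>
    let ?X = "g i ` (players G \<times> actions G)"
    have "bounded ?X" using G by (intro finite_imp_bounded) (auto simp: infinite_past_game_def)
    then obtain c where c: "\<And>x. x \<in> ?X \<Longrightarrow> \<bar>x\<bar> \<le> c" by (auto simp: bounded_real)
    have "\<bar>g i (active G (- int k, before r (- int k)), r (- int k))\<bar> \<le> c" for k
    proof (intro c imageI SigmaI)
      have "(- int k, before r (- int k)) \<in> positions G"
        using r before_in_stage_positions[of r G 1 "- int k"]
        by (auto simp: positions_def runs_eq_stage_positions)
      then show "active G (- int k, before r (- int k)) \<in> players G"
        using G by (auto simp: infinite_past_game_def)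
      show "r (- int k) \<in> actions G" using r by (auto simp: runs_def)
    qed
    then have le: "norm (f r k) \<le> c * \<delta> ^ k" for k
      using \<delta> by (simp add: f_def abs_mult mult.commute mult_right_mono)
    have "summable (\<lambda>k. c * \<delta> ^ k)" using \<delta> by (intro summable_mult summable_geometric) auto
    then show ?thesis using le by (rule summable_comparison_test')
  qed
  have "f r (k + d) = f r' (k + d)" for k
  proof -
    have e: "r m = r' m" if "m < 1 - int d" for m
      using fun_cong[OF eq, of m] that by (simp add: before_def)
    then have "before r (- int (k + d)) = before r' (- int (k + d))"
      by (auto simp: before_def restrict_def)
    then show ?thesis using e[of "- int (k + d)"] by (simp add: f_def)
  qed
  then show ?thesis
    using suminf_split_initial_segment[OF summable[OF r(1)], of d]
      suminf_split_initial_segment[OF summable[OF r(2)], of d] by simp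
qed

section \<open>The backward induction profile is an equilibrium of every subgame\<close>

text \<open>Both restrictions serve membership in the extensional sets \<open>profiles\<close> and
  \<open>strategies\<close>; \<open>nat (- n)\<close> is the number of stages after stage
  \<open>n\<close>.\<close>

definition backward_profile ::
  "('i, 'a) game \<Rightarrow> ('i \<Rightarrow> 'i \<times> 'a \<Rightarrow> real) \<Rightarrow> real \<Rightarrow> 'i \<Rightarrow> 'a position \<Rightarrow> 'a" where
  "backward_profile G g \<delta> = (\<lambda>i\<in>players G. \<lambda>(n, p)\<in>{p \<in> positions G. active G p = i}.
     backward_action G g \<delta> (nat (- n)) p)"

lemma backward_profile_apply:
  assumes "(n, p) \<in> positions G" "active G (n, p) \<in> players G"
  shows "backward_profile G g \<delta> (active G (n, p)) (n, p) = backward_action G g \<delta> (nat (- n)) p"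
  using assms by (simp add: backward_profile_def)

lemma backward_profile_in_profiles:
  assumes "finite (actions G)" "actions G \<noteq> {}"
  shows "backward_profile G g \<delta> \<in> profiles G"
  using optimal_action(1)[OF assms refl]
  by (auto simp: backward_profile_def profiles_def strategies_def split: prod.splits)

text \<open>\<open>J\<close> holds the players whose strategies in \<open>t\<close> are left open:
  \<open>J = {}\<close> covers the induced profile itself, \<open>J = {i}\<close> a deviation by
  \<open>i\<close>.\<close>

lemma generated_backward_profile:
  assumes G: "infinite_past_game G" and p: "p \<in> stage_positions G n" and n: "n \<le> 0"
    and gen: "generated (subgame G (n, p)) t \<rho>"
    and t: "\<And>j. j \<notin> J \<Longrightarrow> t j = induced_profile G (backward_profile G g \<delta>) (n, p) j"
  defines "r \<equiv> append_at n p \<rho>"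
  assumes m: "m \<in> {n..0}" and J: "active G (m, before r m) \<notin> J"
  shows "r m = backward_action G g \<delta> (nat (- m)) (before r m)"
proof -
  note g = generated_subgame[OF gen p n, folded r_def]
  have pos: "(m, before r m) \<in> positions G"
    using g(1) m before_in_stage_positions[of r G 1 m]
    by (auto simp: positions_def runs_eq_stage_positions)
  then have pl: "active G (m, before r m) \<in> players G" using G by (auto simp: infinite_past_game_def)
  have "r m = induced_profile G (backward_profile G g \<delta>) (n, p) (active G (m, before r m))
      (m, restrict \<rho> {n..<m})"
    using g(4)[OF m] t[OF J] by simp
  also have "\<dots> = backward_profile G g \<delta> (active G (m, before r m)) (m, before r m)"
    using induced_profile_apply[OF g(3)[OF m]] pl g(5)[OF m] by simp
  finally show ?thesis using backward_profile_apply[OF pos pl] by simp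
qed

lemma generated_outcome:
  assumes G: "infinite_past_game G" and p: "p \<in> stage_positions G n" and n: "n \<le> 0"
    and s: "s \<in> profiles G" and t: "t \<in> finite_profiles (subgame G (n, p))"
  shows "generated (subgame G (n, p)) t (outcome (subgame G (n, p)) t)"
  unfolding outcome_def
proof (rule theI'[of "generated (subgame G (n, p)) t"], rule generated_ex1[OF _ t])
  have "(n, p) \<in> positions G" using p n by (simp add: positions_def)
  then show "factive (subgame G (n, p)) \<in> histories (subgame G (n, p)) \<rightarrow> fplayers (subgame G (n, p))"
    using subgame_well_defined(1) G s by blast
  show "start (subgame G (n, p)) \<le> 0" using n by (simp add: subgame_def)
qed

text \<open>The continuation value of \<open>i\<close> at \<open>p\<close> is attained by the
  profile and bounds every deviation by \<open>i\<close>, over all stages at once. What accrues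
  before stage \<open>n\<close> is common to both runs and cancels.\<close>

lemma nash_equilibrium_backward_profile:
  assumes G: "infinite_past_game G" and \<delta>: "0 < \<delta>" "\<delta> < 1"
    and pay: "\<forall>i\<in>players G. \<forall>r\<in>runs G. payoff G i r =
      (1 - \<delta>) * (\<Sum>k. \<delta> ^ k * g i (active G (- int k, before r (- int k)), r (- int k)))"
    and p: "p \<in> stage_positions G n" and n: "n \<le> 0"
  shows "nash_equilibrium (subgame G (n, p)) (induced_profile G (backward_profile G g \<delta>) (n, p))"
    (is "nash_equilibrium ?F ?t")
  unfolding nash_equilibrium_def
proof (intro conjI ballI)
  have A: "finite (actions G)" "actions G \<noteq> {}" using G by (auto simp: infinite_past_game_def)
  note s = backward_profile_in_profiles[OF A, of g \<delta>]
  have np: "(n, p) \<in> positions G" using p n by (simp add: positions_def)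
  show t: "?t \<in> finite_profiles ?F" using subgame_well_defined(2)[OF G np s] .
  fix i \<tau> assume "i \<in> fplayers ?F" and \<tau>: "\<tau> \<in> finite_strategies ?F i"
  then have i: "i \<in> players G" by (simp add: subgame_def)
  have t': "?t(i := \<tau>) \<in> finite_profiles ?F"
    using t \<tau> i by (auto simp: finite_profiles_def PiE_iff extensional_def subgame_def)
  note gen = generated_outcome[OF G p n s t] and gen' = generated_outcome[OF G p n s t']
  define r r' where rr: "r = append_at n p (outcome ?F ?t)" "r' = append_at n p (outcome ?F (?t(i := \<tau>)))"
  \<comment> \<open>The stages \<open>n, ..., 0\<close> number \<open>d\<close>, and
    \<open>n = 1 - int d\<close> is the stage where \<open>continuation_value G g \<delta> d\<close>
    is evaluated.\<close>
  define d where "d = nat (1 - n)"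
  have nd: "n = 1 - int d" using n by (simp add: d_def)
  have runs: "r \<in> runs G" "r' \<in> runs G" "before r n = p" "before r' n = p"
    using generated_subgame(1,2)[OF gen p n] generated_subgame(1,2)[OF gen' p n] by (auto simp: rr)
  let ?f = "\<lambda>r k. \<delta> ^ k * g i (active G (- int k, before r (- int k)), r (- int k))"
  have "\<forall>k<d. active G (- int k, before r (- int k)) \<notin> {} \<longrightarrow>
      r (- int k) = backward_action G g \<delta> k (before r (- int k))"
    using generated_backward_profile[OF G p n gen, of "{}" g \<delta>] by (auto simp: rr nd)
  from continuation_sum_le(2)[OF A runs(1) this]
  have "(\<Sum>k<d. ?f r k) = continuation_value G g \<delta> d p i" using runs(3) by (simp add: nd)
  moreover have "\<forall>k<d. active G (- int k, before r' (- int k)) \<notin> {i} \<longrightarrow>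
      r' (- int k) = backward_action G g \<delta> k (before r' (- int k))"
    using generated_backward_profile[OF G p n gen', of "{i}" g \<delta>] by (auto simp: rr nd)
  from continuation_sum_le(1)[OF A runs(2) this]
  have "(\<Sum>k<d. ?f r' k) \<le> continuation_value G g \<delta> d p i" using runs(4) by (simp add: nd)
  moreover have "(\<Sum>k. ?f r k) - (\<Sum>k<d. ?f r k) = (\<Sum>k. ?f r' k) - (\<Sum>k<d. ?f r' k)"
    using runs nd by (intro payoff_split[OF G \<delta> i]) auto
  ultimately have "(\<Sum>k. ?f r' k) \<le> (\<Sum>k. ?f r k)" by linarith
  then have "payoff G i r' \<le> payoff G i r" using pay i runs \<delta> by simp
  then show "fpayoff ?F i (outcome ?F (?t(i := \<tau>))) \<le> fpayoff ?F i (outcome ?F ?t)"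
    by (simp add: subgame_def rr)
qed

section \<open>A consistent run by compactness\<close>

lemma backward_run_exists:
  assumes G: "infinite_past_game G"
    and act: "\<forall>n\<le>0. continuous_map (stage_topology G n) (discrete_topology (players G))
                 (\<lambda>p. active G (n, p))"
  obtains r where "r \<in> runs G"
    and "\<And>k. r (- int k) = backward_action G g \<delta> k (before r (- int k))"
proof -
  have A: "finite (actions G)" "actions G \<noteq> {}" using G by (auto simp: infinite_past_game_def)
  let ?X = "stage_topology G 1"
  let ?E = "\<lambda>k. {r \<in> topspace ?X. r (- int k) = backward_action G g \<delta> k (before r (- int k))}"
  \<comment> \<open>With \<open>k\<le>N\<close> the index set is never empty; an empty intersection
    would be \<open>UNIV\<close> instead of a closed set of runs.\<close>
  let ?C = "\<lambda>N. \<Inter>k\<le>N. ?E k"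
  have top: "topspace ?X = runs G"
    by (simp add: topspace_stage_topology runs_eq_stage_positions)
  have "compact_space ?X"
    using A by (simp add: stage_topology_def compact_space_product_topology compact_space_discrete_topology)
  moreover have "closedin ?X (?C N)" for N :: nat
  proof (intro closedin_INT closedin_locally_constant)
    fix k :: nat
    have "continuous_map ?X (discrete_topology (actions G)) (\<lambda>r. r (- int k))"
      unfolding stage_topology_def by (rule continuous_map_product_projection) auto
    then show "locally_constant ?X (\<lambda>r. r (- int k))" by (rule locally_constantI_continuous_map)
    show "locally_constant ?X (\<lambda>r. backward_action G g \<delta> k (before r (- int k)))"
      by (rule locally_constant_compose[OF continuous_map_before
            locally_constant_continuation(2)[OF A act]]) simp
  qed auto
  moreover have "?C N \<noteq> {}" for N :: nat
  proof -
    let ?n = "- int N"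
    obtain a where a: "a \<in> actions G" using A by auto
    \<comment> \<open>Any past before stage \<open>- int N\<close> will do, since
      \<open>?C N\<close> constrains only the stages from there on; a constant one is taken.\<close>
    define p where "p = (\<lambda>k\<in>{..<?n}. a)"
    have p: "p \<in> stage_positions G ?n" using a by (auto simp: p_def stage_positions_def)
    note s = backward_profile_in_profiles[OF A, of g \<delta>]
    let ?t = "induced_profile G (backward_profile G g \<delta>) (?n, p)"
    have "?t \<in> finite_profiles (subgame G (?n, p))"
      using subgame_well_defined(2)[OF G _ s] p by (simp add: positions_def)
    from generated_outcome[OF G p _ s this]
    have gen: "generated (subgame G (?n, p)) ?t (outcome (subgame G (?n, p)) ?t)" by simp
    define r where "r = append_at ?n p (outcome (subgame G (?n, p)) ?t)"
    have "r \<in> runs G" using generated_subgame(1)[OF gen p] by (simp add: r_def)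
    moreover have "r (- int k) = backward_action G g \<delta> k (before r (- int k))" if "k \<le> N" for k
      using generated_backward_profile[OF G p _ gen, of "{}" g \<delta> "- int k"] that by (simp add: r_def)
    ultimately have "r \<in> ?C N" using top by auto
    then show ?thesis by blast
  qed
  moreover have "decseq ?C" by (intro decseq_SucI) (auto simp: atMost_Suc)
  ultimately have "(\<Inter>N. ?C N) \<noteq> {}" by (intro compact_space_imp_nest)
  then obtain r where "r \<in> (\<Inter>N. ?C N)" by blast
  then show ?thesis using that[of r] top by auto
qed

theorem corollary46:
  fixes G :: "('i, 'a) game"
    and g :: "'i \<Rightarrow> 'i \<times> 'a \<Rightarrow> real"
    and \<delta> :: real
  assumes "infinite_past_game G"
    and "\<forall>n\<le>0. continuous_map (stage_topology G n) (discrete_topology (players G))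
                 (\<lambda>p. active G (n, p))"
    and "0 < \<delta>" and "\<delta> < 1"
    and "\<forall>i\<in>players G. \<forall>r\<in>runs G.
           payoff G i r =
             (1 - \<delta>) * (\<Sum>k. \<delta> ^ k * g i (active G (- int k, before r (- int k)), r (- int k)))"
  shows "\<exists>s r. equilibrium G s r"
proof -
  have A: "finite (actions G)" "actions G \<noteq> {}"
    using assms(1) by (auto simp: infinite_past_game_def)
  obtain r where r: "r \<in> runs G"
    "\<And>k. r (- int k) = backward_action G g \<delta> k (before r (- int k))"
    using backward_run_exists[OF assms(1,2)] by metis
  have pos: "before r n \<in> stage_positions G n" if "n \<le> 0" for n
    using r(1) that by (simp add: runs_eq_stage_positions before_in_stage_positions)
  have "consistent_with G i (backward_profile G g \<delta> i) r" if "i \<in> players G" for i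
    unfolding consistent_with_def
  proof (intro allI impI)
    fix n :: int assume n: "n \<le> 0" and i: "active G (n, before r n) = i"
    have "(n, before r n) \<in> positions G" using pos n by (simp add: positions_def)
    then show "r n = backward_profile G g \<delta> i (n, before r n)"
      using backward_profile_apply[of n "before r n" G g \<delta>] i that r(2)[of "nat (- n)"] n by simp
  qed
  then have "r \<in> consistent_runs G (backward_profile G g \<delta>)"
    using r(1) by (simp add: consistent_runs_def)
  \<comment> \<open>The Nash property holds at every position of every stage; the choice of
    \<open>r\<close> matters for consistency alone.\<close>
  then have "equilibrium G (backward_profile G g \<delta>) r"
    using nash_equilibrium_backward_profile[OF assms(1,3,4,5) pos]
      backward_profile_in_profiles[OF A] by (simp add: equilibrium_def)
  then show ?thesis by blast
qed

end
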